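(* Let $G(t,u,v,z,x)=\sum_{w} t^{\mathrm{length}(w)}u^{\mathrm{asc}(w)}v^{\mathrm{last}(w)}z^{\mathrm{zeros}(w)}x^{\mathrm{run}(w)}$, where the sum is over all ascent sequences $w$ (including the empty one). For $s\ge 1$ put $\delta_s=u-(1-t)^s(u-1)$, $\gamma_s=u-(1-zt)(1-t)^{s-1}(u-1)$, $\bar\delta_s=uv-(1-t)^s(uv-1)$, $\bar\gamma_s=uv-(1-zt)(1-t)^{s-1}(uv-1)$, and $\delta_0=\gamma_0=\bar\delta_0=\bar\gamma_0=1$. Then, as formal power series, $$G(t,u,v,z,x)=\frac{1}{1-tz}+\frac{t^2zxu}{(1-tzx)(v\delta_1-1)}\Big(v(v-1)+t(1-u)(z(v-1)-v)\sum_{s\ge 0}\frac{u^s(1-t)^s}{\delta_s\delta_{s+1}\prod_{i=1}^{s+1}\gamma_i}+uv^3t(1-uv)\sum_{s\ge0}\frac{(uv)^s(1-t)^s}{\bar\delta_s\bar\delta_{s+1}\prod_{i=1}^{s+1}\bar\gamma_i}\Big).$$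
   Context: An ascent sequence of length $n$ is a sequence $(x_1,\dots,x_n)$ of nonnegative integers with $x_1=0$ and $x_i\in[0,1+\mathrm{asc}(x_1,\dots,x_{i-1})]$ for $2\le i\le n$, where $\mathrm{asc}(y_1,\dots,y_k)=|\{1\le j<k: y_j<y_{j+1}\}|$; the empty sequence is also an ascent sequence. For an ascent sequence $w$: $\mathrm{length}(w)$ is its number of entries, $\mathrm{asc}(w)$ its number of ascents, $\mathrm{last}(w)$ its rightmost entry (0 for the empty sequence), $\mathrm{zeros}(w)$ its number of entries equal to 0, and $\mathrm{run}(w)$ is the number of 0's to the left of the leftmost nonzero entry, with $\mathrm{run}(w)=0$ if $w$ has no nonzero entry. (This series is also the generating function of (2+2)-free posets by size, number of levels, level of the minimum maximal element, number of minimal elements, and size of the last nontrivial down-set.) All series are formal power series in $t,u,v,z,x$ over $\mathbb{Q}$; $v\delta_1-1$ has constant term $-1$ and each $\delta_s,\gamma_s,\bar\delta_s,\bar\gamma_s$ has constant term $1$, so all quotients are formal power series, and the $s$-th summands are divisible by $u^s$, so the sums converge formally. *)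

theory Defs
  imports "HOL-Computational_Algebra.Formal_Power_Series"
begin

definition asc :: "nat list \<Rightarrow> nat" where
  "asc w = card {j. j + 1 < length w \<and> w ! j < w ! (j + 1)}"

definition ascent_seq :: "nat list \<Rightarrow> bool" where
  "ascent_seq w \<longleftrightarrow> w = [] \<or>
     (w ! 0 = 0 \<and> (\<forall>i. 1 \<le> i \<and> i < length w \<longrightarrow> w ! i \<le> 1 + asc (take i w)))"

definition lastv :: "nat list \<Rightarrow> nat" where
  "lastv w = (if w = [] then 0 else last w)"

definition zeros :: "nat list \<Rightarrow> nat" where
  "zeros w = length (filter (\<lambda>a. a = 0) w)"

definition run :: "nat list \<Rightarrow> nat" where
  "run w = (if \<exists>a\<in>set w. a \<noteq> 0 then length (takeWhile (\<lambda>a. a = 0) w) else 0)"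

text \<open>Five-variable formal power series over the rationals, realised as nested
  one-variable power series: the outermost variable is u, then t, v, z, and the
  innermost is x.\<close>

type_synonym mfps = "rat fps fps fps fps fps"

definition U :: mfps where "U = fps_X"
definition T :: mfps where "T = fps_const fps_X"
definition V :: mfps where "V = fps_const (fps_const fps_X)"
definition Z :: mfps where "Z = fps_const (fps_const (fps_const fps_X))"
definition X :: mfps where "X = fps_const (fps_const (fps_const (fps_const fps_X)))"

definition G :: mfps where
  "G = Abs_fps (\<lambda>a. Abs_fps (\<lambda>n. Abs_fps (\<lambda>l. Abs_fps (\<lambda>k. Abs_fps (\<lambda>r.
      of_nat (card {w. ascent_seq w \<and> length w = n \<and> asc w = a \<and> lastv w = l
                        \<and> zeros w = k \<and> run w = r}))))))"

definition delta :: "nat \<Rightarrow> mfps" where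
  "delta s = (if s = 0 then 1 else U - (1 - T) ^ s * (U - 1))"

definition gamma :: "nat \<Rightarrow> mfps" where
  "gamma s = (if s = 0 then 1 else U - (1 - Z * T) * (1 - T) ^ (s - 1) * (U - 1))"

definition deltabar :: "nat \<Rightarrow> mfps" where
  "deltabar s = (if s = 0 then 1 else U * V - (1 - T) ^ s * (U * V - 1))"

definition gammabar :: "nat \<Rightarrow> mfps" where
  "gammabar s = (if s = 0 then 1 else U * V - (1 - Z * T) * (1 - T) ^ (s - 1) * (U * V - 1))"

end

theory Submission
  imports Defs
begin

text \<open>Kernel method. Let \<open>N(y)\<close> be the generating function of the ascent sequences with a nonzero entry,
  with \<open>y\<close> in place of \<open>V\<close>. Appending a last entry gives
  \<open>(y * delta 1 - 1) * N(y) = (y - 1) * y * A + T * (Z * (y - 1) - y) * N(1) + T * U * y\<^sup>2 * N(1)(U * y)\<close>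
  for every series \<open>y\<close>, where \<open>A\<close> counts the words \<open>0\<^sup>r 1\<close> and \<open>N(1)(U * y)\<close> is \<open>N(1)\<close> with \<open>U * y\<close>
  substituted for \<open>U\<close>. At \<open>y = 1 / delta 1\<close> the left side vanishes, which leaves
  \<open>delta 1 * gamma 1 * N(1) = (1 - U) * A + U * N(1)(U / delta 1)\<close>. This determines \<open>N(1)\<close> coefficient by
  coefficient in \<open>U\<close>, and since \<open>U \<mapsto> U / delta 1\<close> maps \<open>delta s\<close> and \<open>gamma s\<close> to
  \<open>delta (s + 1) / delta 1\<close> and \<open>gamma (s + 1) / delta 1\<close>, the series in the theorem is the solution.
  Finally take \<open>y = V\<close>.\<close>

unbundle fps_syntax

subsection \<open>Sums of shifted power series\<close>

text \<open>The formal sum of \<open>fps_X ^ i * f i\<close>, given coefficientwise: terms with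
  \<open>i > n\<close> cannot reach coefficient \<open>n\<close>.\<close>

definition fps_series :: "(nat \<Rightarrow> 'a::comm_ring_1 fps) \<Rightarrow> 'a fps" where
  "fps_series f = Abs_fps (\<lambda>n. \<Sum>i\<le>n. f i $ (n - i))"

text \<open>The same for the inner variable: \<open>fps_series2 f\<close> is the sum of \<open>T ^ n * f n\<close>. It need not
  converge in the metric on power series, which only sees the outermost variable.\<close>

definition fps_series2 :: "(nat \<Rightarrow> 'a::comm_ring_1 fps fps) \<Rightarrow> 'a fps fps" where
  "fps_series2 f = Abs_fps (\<lambda>m. fps_series (\<lambda>n. f n $ m))"

lemma fps_series_rec: "fps_series f = f 0 + fps_X * fps_series (\<lambda>i. f (Suc i))"
proof (rule fps_ext)
  fix n show "fps_series f $ n = (f 0 + fps_X * fps_series (\<lambda>i. f (Suc i))) $ n"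
    by (cases n) (simp_all add: fps_series_def sum.atMost_Suc_shift del: sum.atMost_Suc)
qed

lemma fps_series_truncate:
  "fps_series f = (\<Sum>i<N. fps_X ^ i * f i) + fps_X ^ N * fps_series (\<lambda>i. f (i + N))"
proof (induction N)
  case (Suc N)
  have "fps_series (\<lambda>i. f (i + N)) = f N + fps_X * fps_series (\<lambda>i. f (i + Suc N))"
    by (subst fps_series_rec) simp
  then show ?case using Suc by (simp add: algebra_simps)
qed simp

text \<open>Agreement modulo \<open>fps_X ^ Suc n\<close> settles coefficient \<open>n\<close>. With
  \<open>fps_series_truncate\<close> this reduces identities between infinite sums to finite
  ones.\<close>

lemma fps_eqI_mod_X_power:
  fixes f g :: "'a::comm_ring_1 fps"
  assumes "\<And>N. \<exists>r. f = g + fps_X ^ N * r"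
  shows "f = g"
proof (rule fps_ext)
  fix n
  obtain r where "f = g + fps_X ^ Suc n * r" using assms by blast
  then show "f $ n = g $ n" by (simp add: fps_X_power_mult_nth del: power_Suc)
qed

lemma fps_series_add: "fps_series (\<lambda>i. f i + g i) = fps_series f + fps_series g"
  by (simp add: fps_series_def fps_eq_iff sum.distrib)

lemma fps_series_sum: "fps_series (\<lambda>i. \<Sum>j\<in>J. f j i) = (\<Sum>j\<in>J. fps_series (f j))"
  by (simp add: fps_series_def fps_eq_iff fps_sum_nth sum.swap[of _ J])

lemma fps_series_mult_left: "fps_series (\<lambda>i. c * f i) = c * fps_series f"
proof (rule fps_eqI_mod_X_power)
  fix N
  have "fps_series (\<lambda>i. c * f i) = c * fps_series f + fps_X ^ N *
     (fps_series (\<lambda>i. c * f (i + N)) - c * fps_series (\<lambda>i. f (i + N)))"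
    by (subst (1 2) fps_series_truncate[of _ N]) (simp add: algebra_simps sum_distrib_left)
  then show "\<exists>r. fps_series (\<lambda>i. c * f i) = c * fps_series f + fps_X ^ N * r" by blast
qed

text \<open>Substitution is additive and multiplicative on the first \<open>N\<close> terms, where
  \<open>fps_X ^ i\<close> turns into \<open>fps_X ^ i * d ^ i\<close>; the tails on both sides stay
  divisible by \<open>fps_X ^ N\<close>.\<close>

lemma fps_series_compose:
  fixes f :: "nat \<Rightarrow> 'a::idom fps"
  shows "fps_series f oo (fps_X * d) = fps_series (\<lambda>i. d ^ i * (f i oo (fps_X * d)))"
proof (rule fps_eqI_mod_X_power)
  fix N
  have X: "fps_X ^ i oo (fps_X * d) = fps_X ^ i * d ^ i" for i
    by (simp add: fps_X_power_compose power_mult_distrib)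
  have "fps_series f oo (fps_X * d) = fps_series (\<lambda>i. d ^ i * (f i oo (fps_X * d))) + fps_X ^ N *
     (d ^ N * (fps_series (\<lambda>i. f (i + N)) oo (fps_X * d))
      - fps_series (\<lambda>i. d ^ (i + N) * (f (i + N) oo (fps_X * d))))"
    by (subst (1 2) fps_series_truncate[of _ N])
      (simp add: algebra_simps fps_compose_add_distrib fps_compose_sum_distrib
        fps_compose_mult_distrib X)
  then show "\<exists>r. fps_series f oo (fps_X * d)
      = fps_series (\<lambda>i. d ^ i * (f i oo (fps_X * d))) + fps_X ^ N * r" by blast
qed

text \<open>Connects the formal sum to the infinite sums of the theorem: each coefficient of the
  partial sums is eventually constant.\<close>

lemma fps_series_sums: "(\<lambda>i. fps_X ^ i * f i) sums fps_series f"
  unfolding sums_def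
proof (rule tendsto_fpsI)
  fix n
  have "fps_nth (\<Sum>i<k. fps_X ^ i * f i) n = fps_nth (fps_series f) n" if "k \<ge> Suc n" for k
    using that by (subst fps_series_truncate[of f k]) (simp add: fps_X_power_mult_nth)
  then show "\<forall>\<^sub>F k in sequentially. fps_nth (\<Sum>i<k. fps_X ^ i * f i) n
      = fps_nth (fps_series f) n"
    using eventually_sequentially by blast
qed

lemma fps_series2_rec:
  "fps_series2 f = f 0 + fps_const fps_X * fps_series2 (\<lambda>n. f (Suc n))"
  by (rule fps_ext) (simp add: fps_series2_def, subst fps_series_rec, simp)

lemma fps_series2_add: "fps_series2 (\<lambda>n. f n + g n) = fps_series2 f + fps_series2 g"
  by (simp add: fps_series2_def fps_eq_iff fps_series_add)

lemma fps_series2_mult_left: "fps_series2 (\<lambda>n. c * f n) = c * fps_series2 f"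
  by (rule fps_ext)
    (simp add: fps_series2_def fps_mult_nth fps_series_sum fps_series_mult_left)

lemma fps_series2_diff: "fps_series2 (\<lambda>n. f n - g n) = fps_series2 f - fps_series2 g"
  using fps_series2_add[of "\<lambda>n. f n - g n" g] by simp

text \<open>Each outer coefficient of a composition is a finite linear combination of outer
  coefficients of the series composed, and \<open>fps_series\<close> is linear.\<close>

lemma fps_series2_compose: "fps_series2 f oo h = fps_series2 (\<lambda>n. f n oo h)"
proof (rule fps_ext)
  fix m
  have "(fps_series2 f oo h) $ m = (\<Sum>i=0..m. (h ^ i) $ m * fps_series (\<lambda>n. f n $ i))"
    by (simp add: fps_compose_nth fps_series2_def mult.commute)
  also have "\<dots> = fps_series (\<lambda>n. \<Sum>i=0..m. (h ^ i) $ m * f n $ i)"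
    by (simp add: fps_series_sum fps_series_mult_left)
  finally show "(fps_series2 f oo h) $ m = fps_series2 (\<lambda>n. f n oo h) $ m"
    by (simp add: fps_compose_nth fps_series2_def mult.commute)
qed

lemma fps_series2_geometric: "fps_series2 (\<lambda>n. c ^ n) * (1 - fps_const fps_X * c) = 1"
proof -
  have "fps_series2 (\<lambda>n. c ^ n) = 1 + fps_const fps_X * (c * fps_series2 (\<lambda>n. c ^ n))"
    by (subst fps_series2_rec) (simp add: fps_series2_mult_left)
  then have "fps_series2 (\<lambda>n. c ^ n) - fps_const fps_X * (c * fps_series2 (\<lambda>n. c ^ n)) = 1"
    by (metis add_diff_cancel_right')
  then show ?thesis by (simp add: algebra_simps)
qed

text \<open>The difference of two solutions satisfies the homogeneous equation, and the factor
  \<open>fps_X\<close> makes its coefficient \<open>n\<close> depend only on coefficients below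
  \<open>n\<close>.\<close>

lemma fps_compose_equation_unique:
  fixes P Q :: "'a::idom fps"
  assumes P: "P = B + fps_X * c * (P oo (fps_X * d))"
    and Q: "Q = B + fps_X * c * (Q oo (fps_X * d))"
  shows "P = Q"
proof -
  define R where "R = P - Q"
  have "R = fps_X * c * (P oo (fps_X * d)) - fps_X * c * (Q oo (fps_X * d))"
    unfolding R_def using P Q by (metis add_diff_cancel_left)
  also have "\<dots> = fps_X * (c * (R oo (fps_X * d)))"
    by (simp add: R_def fps_compose_sub_distrib algebra_simps)
  finally have R: "R = fps_X * (c * (R oo (fps_X * d)))" .
  have "R $ n = 0" for n
  proof (induction n rule: less_induct)
    case (less n)
    show ?case
    proof (cases n)
      case 0
      then show ?thesis by (metis R fps_X_mult_nth)
    next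
      case (Suc m)
      have "R $ n = (c * (R oo (fps_X * d))) $ m"
        using Suc by (metis R fps_X_mult_nth diff_Suc_1 nat.distinct(1))
      also have "\<dots> = 0"
        using less Suc by (auto simp: fps_mult_nth fps_compose_nth intro!: sum.neutral)
      finally show ?thesis .
    qed
  qed
  then show ?thesis by (simp add: R_def fps_eq_iff)
qed

section \<open>Inverses of series in several variables\<close>

lemma left_inverse_eq_right_inverse:
  fixes a b c :: "'a::monoid_mult"
  assumes "a * b = 1" "b * c = 1"
  shows "a = c"
proof -
  have "a = a * (b * c)" by (simp add: assms(2))
  also have "\<dots> = c" by (simp add: mult.assoc[symmetric] assms(1))
  finally show ?thesis .
qed

lemma fps_mult_inverse_if_const:
  fixes f :: "'a::{comm_ring_1,inverse} fps"
  assumes "f $ 0 * inverse (f $ 0) = 1"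
  shows "f * inverse f = 1"
  using fps_right_inverse[of f "inverse (f $ 0)"] assms by (simp add: fps_inverse_def)

text \<open>An invertible constant term makes a one-variable series invertible; applied at each of
  the five levels, this leads down to a nonzero rational.\<close>

lemma mfps_mult_inverse:
  fixes f :: mfps
  assumes "f $ 0 $ 0 $ 0 $ 0 $ 0 \<noteq> 0"
  shows "f * inverse f = 1"
  by (intro fps_mult_inverse_if_const) (use assms in simp)

subsection \<open>Ascent sequences and their last entry\<close>

lemma asc_snoc: "asc (w @ [x]) = asc w + of_bool (w \<noteq> [] \<and> last w < x)"
proof -
  define S where "S = {j. j + 1 < length w \<and> w ! j < w ! (j + 1)}"
  have "j + 1 < length (w @ [x]) \<and> (w @ [x]) ! j < (w @ [x]) ! (j + 1) \<longleftrightarrow>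
      j \<in> (if w \<noteq> [] \<and> last w < x then insert (length w - 1) S else S)" for j
  proof (cases "length w = Suc j")
    case True
    then have "w \<noteq> []" by auto
    then show ?thesis using True by (simp add: S_def nth_append last_conv_nth)
  next
    case False
    then show ?thesis by (auto simp: S_def nth_append)
  qed
  then have "{j. j + 1 < length (w @ [x]) \<and> (w @ [x]) ! j < (w @ [x]) ! (j + 1)}
      = (if w \<noteq> [] \<and> last w < x then insert (length w - 1) S else S)"
    by blast
  moreover have "finite S" "length w - 1 \<notin> S"
    by (auto simp: S_def intro: finite_subset[of _ "{..<length w}"])
  moreover have "asc w = card S"
    by (simp add: asc_def S_def)
  ultimately show ?thesis
    by (simp add: asc_def[of "w @ [x]"])
qed

lemma ascent_seq_snoc:
  "ascent_seq (w @ [x]) \<longleftrightarrow> ascent_seq w \<and> x \<le> (if w = [] then 0 else 1 + asc w)"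
proof (cases "w = []")
  case False
  have "(\<forall>i. 1 \<le> i \<and> i < length (w @ [x]) \<longrightarrow>
        (w @ [x]) ! i \<le> 1 + asc (take i (w @ [x])))
    \<longleftrightarrow> (\<forall>i. 1 \<le> i \<and> i < length w \<longrightarrow> w ! i \<le> 1 + asc (take i w))
        \<and> x \<le> 1 + asc w"
    using False by (auto simp: less_Suc_eq nth_append all_conj_distrib Suc_le_eq)
  then show ?thesis using False by (simp add: ascent_seq_def nth_append)
qed (simp add: ascent_seq_def)

lemma zeros_snoc: "zeros (w @ [x]) = zeros w + of_bool (x = 0)"
  by (simp add: zeros_def)

lemma lastv_snoc [simp]: "lastv (w @ [x]) = x"
  by (simp add: lastv_def)

lemma run_snoc:
  "run (w @ [x]) =
    (if \<exists>a\<in>set w. a \<noteq> 0 then run w else if x \<noteq> 0 then length w else 0)"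
  by (auto simp: run_def takeWhile_append2)

text \<open>A new entry that makes an ascent is at most \<open>1 + asc w\<close>, the new number of
  ascents; any other is at most the old last entry. The bound allows the choices for the next entry
  to be split at the last one.\<close>

lemma lastv_le_asc: "ascent_seq w \<Longrightarrow> lastv w \<le> asc w"
proof (induction w rule: rev_induct)
  case (snoc x w)
  then show ?case
    by (auto simp: ascent_seq_snoc asc_snoc lastv_def split: if_splits)
qed (simp add: lastv_def)

lemma asc_replicate [simp]: "asc (replicate n 0) = 0"
  by (auto simp: asc_def card_eq_0_iff)

lemma ascent_seq_replicate [simp]: "ascent_seq (replicate n 0)"
  by (cases n) (simp_all add: ascent_seq_def del: replicate.simps)

section \<open>Generating functions of words with a nonzero entry, by length\<close>

definition weight :: "mfps \<Rightarrow> nat list \<Rightarrow> mfps" where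
  "weight y w = U ^ asc w * y ^ lastv w * Z ^ zeros w * X ^ run w"

text \<open>All-zero words are set apart: their \<open>run\<close> is 0 by convention, and they
  produce the summand \<open>1 / (1 - T * Z)\<close>.\<close>

definition nonzero_seqs :: "nat \<Rightarrow> nat list set" where
  "nonzero_seqs n = {w. ascent_seq w \<and> length w = n \<and> (\<exists>a\<in>set w. a \<noteq> 0)}"

lemma nonzero_seqs_0 [simp]: "nonzero_seqs 0 = {}"
  by (auto simp: nonzero_seqs_def)

text \<open>Deleting the last entry leaves either such a word again or a block of zeros. After a
  nonempty block of zeros the only nonzero entry allowed is 1; after the empty word only 0 is
  allowed.\<close>

lemma nonzero_seqs_Suc:
  "nonzero_seqs (Suc n) = (\<lambda>(w, x). w @ [x]) ` (SIGMA w:nonzero_seqs n. {..1 + asc w})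
     \<union> (if n = 0 then {} else {replicate n 0 @ [1]})"
  (is "_ = ?B")
proof
  show "nonzero_seqs (Suc n) \<subseteq> ?B"
  proof
    fix v assume v: "v \<in> nonzero_seqs (Suc n)"
    then obtain w x where wx: "v = w @ [x]" "length w = n"
      by (cases v rule: rev_cases) (auto simp: nonzero_seqs_def)
    show "v \<in> ?B"
    proof (cases "\<exists>a\<in>set w. a \<noteq> 0")
      case True
      then have "w \<in> nonzero_seqs n" "x \<le> 1 + asc w"
        using v wx by (auto simp: nonzero_seqs_def ascent_seq_snoc split: if_splits)
      then show ?thesis unfolding wx by force
    next
      case False
      then have w: "w = replicate n 0"
        using wx by (simp add: replicate_eqI)
      moreover have "n \<noteq> 0 \<and> x = 1"
        using v unfolding wx(1) w by (auto simp: nonzero_seqs_def ascent_seq_snoc split: if_splits)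
      ultimately show ?thesis by (simp add: wx)
    qed
  qed
  show "?B \<subseteq> nonzero_seqs (Suc n)"
    by (auto simp: nonzero_seqs_def ascent_seq_snoc split: if_splits)
qed

lemma finite_nonzero_seqs [simp]: "finite (nonzero_seqs n)"
  by (induction n) (auto simp: nonzero_seqs_Suc)

lemma sum_nonzero_seqs_Suc:
  fixes f :: "nat list \<Rightarrow> 'a::comm_monoid_add"
  shows "sum f (nonzero_seqs (Suc n)) = (\<Sum>w\<in>nonzero_seqs n. \<Sum>x\<le>1 + asc w. f (w @ [x]))
     + (if n = 0 then 0 else f (replicate n 0 @ [1]))"
proof -
  have "sum f (nonzero_seqs (Suc n)) =
      sum f ((\<lambda>(w, x). w @ [x]) ` (SIGMA w:nonzero_seqs n. {..1 + asc w}))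
      + sum f (if n = 0 then {} else {replicate n 0 @ [1]})"
    unfolding nonzero_seqs_Suc
  proof (rule sum.union_disjoint)
    show "finite ((\<lambda>(w, x). w @ [x]) ` (SIGMA w:nonzero_seqs n. {..1 + asc w}))"
      by (intro finite_imageI finite_SigmaI) auto
  qed (auto simp: nonzero_seqs_def)
  also have "sum f ((\<lambda>(w, x). w @ [x]) ` (SIGMA w:nonzero_seqs n. {..1 + asc w}))
      = (\<Sum>(w, x)\<in>(SIGMA w:nonzero_seqs n. {..1 + asc w}). f (w @ [x]))"
    by (subst sum.reindex) (auto simp: inj_on_def case_prod_unfold)
  also have "\<dots> = (\<Sum>w\<in>nonzero_seqs n. \<Sum>x\<le>1 + asc w. f (w @ [x]))"
    by (subst sum.Sigma) auto
  finally show ?thesis by simp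
qed

text \<open>The next entry runs over \<open>0..L\<close> without an ascent and over
  \<open>L + 1..A + 1\<close> with one, which gives geometric sums in \<open>y\<close>. The factor
  \<open>1 - y\<close> evaluates them without division.\<close>

lemma sum_weight_snoc:
  assumes "w \<in> nonzero_seqs n"
  shows "(1 - y) * (\<Sum>x\<le>1 + asc w. weight y (w @ [x]))
    = weight 1 w - y * weight y w + (1 - y) * (Z - 1) * weight 1 w
      + U * y * weight y w - U * y\<^sup>2 * (y ^ asc w * weight 1 w)"
proof -
  define L A where "L = lastv w" and "A = asc w"
  define b where "b = U ^ asc w * Z ^ zeros w * X ^ run w"
  have nz: "w \<noteq> []" "\<exists>a\<in>set w. a \<noteq> 0"
    and LA: "L \<le> A"
    using assms lastv_le_asc by (auto simp: nonzero_seqs_def L_def A_def)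
  have *: "weight y (w @ [x]) =
      (if x = 0 then b * Z else if x \<le> L then b * y ^ x else U * b * y ^ x)" for x
    using nz by (auto simp: weight_def asc_snoc zeros_snoc run_snoc b_def L_def lastv_def)
  have w: "weight 1 w = b" "weight y w = b * y ^ L"
    by (simp_all add: weight_def b_def L_def)
  have split: "{..1 + A} = {..L} \<union> ({..Suc A} - {..L})"
    using LA by auto
  have "(\<Sum>x\<le>1 + A. weight y (w @ [x]))
      = (\<Sum>x\<le>L. weight y (w @ [x])) + (\<Sum>x\<in>{..Suc A} - {..L}. weight y (w @ [x]))"
    by (subst split, rule sum.union_disjoint) auto
  \<comment> \<open>The entry 0 has weight \<open>b * Z\<close>; writing this as
    \<open>b + b * (Z - 1)\<close> completes the geometric sum.\<close>
  also have "(\<Sum>x\<le>L. weight y (w @ [x])) =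
      (\<Sum>x\<le>L. b * y ^ x + (if x = 0 then b * (Z - 1) else 0))"
    by (intro sum.cong) (auto simp: * algebra_simps)
  also have "\<dots> = b * (\<Sum>x\<le>L. y ^ x) + b * (Z - 1)"
    by (simp add: sum.distrib sum_distrib_left)
  also have "(\<Sum>x\<in>{..Suc A} - {..L}. weight y (w @ [x]))
      = (\<Sum>x\<in>{..Suc A} - {..L}. U * b * y ^ x)"
    by (intro sum.cong) (auto simp: *)
  also have "\<dots> = U * b * ((\<Sum>x\<le>Suc A. y ^ x) - (\<Sum>x\<le>L. y ^ x))"
    using LA by (simp add: sum_distrib_left[symmetric] sum_diff del: sum.atMost_Suc)
  finally have *: "(\<Sum>x\<le>1 + A. weight y (w @ [x])) = b * (\<Sum>x\<le>L. y ^ x) + b * (Z - 1)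
      + U * b * ((\<Sum>x\<le>Suc A. y ^ x) - (\<Sum>x\<le>L. y ^ x))" .
  have "(1 - y) * (\<Sum>x\<le>1 + A. weight y (w @ [x]))
     = b * ((1 - y) * (\<Sum>x\<le>L. y ^ x)) + (1 - y) * b * (Z - 1)
       + U * b * ((1 - y) * (\<Sum>x\<le>Suc A. y ^ x) - (1 - y) * (\<Sum>x\<le>L. y ^ x))"
    unfolding * by (simp only: algebra_simps)
  also have "\<dots> = weight 1 w - y * weight y w + (1 - y) * (Z - 1) * weight 1 w
      + U * y * weight y w - U * y\<^sup>2 * (y ^ A * weight 1 w)"
    unfolding sum_gp_basic w by (simp add: algebra_simps power2_eq_square)
  finally show ?thesis by (simp add: A_def)
qed

lemma Z_compose [simp]: "Z oo h = Z" and T_compose [simp]: "T oo h = T"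
  and X_compose [simp]: "X oo h = X" and V_compose [simp]: "V oo h = V"
  by (simp_all add: Z_def T_def X_def V_def)

lemma U_compose [simp]: "h $ 0 = 0 \<Longrightarrow> U oo h = h"
  by (simp add: U_def)

lemma U_nth_0 [simp]: "U $ 0 = 0"
  by (simp add: U_def)

text \<open>Turns the factor \<open>y ^ asc w\<close>, which comes from the upper end of the
  geometric sum, into the substitution of \<open>U * y\<close> for \<open>U\<close>.\<close>

lemma weight_compose: "weight 1 w oo (U * y) = y ^ asc w * weight 1 w"
  by (simp add: weight_def fps_compose_mult_distrib fps_compose_power[symmetric]
      power_mult_distrib algebra_simps)

text \<open>The weights do not record the length; powers of \<open>T\<close> enter only with the sum
  over all layers.\<close>

definition layer :: "mfps \<Rightarrow> nat \<Rightarrow> mfps" where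
  "layer y n = (\<Sum>w\<in>nonzero_seqs n. weight y w)"

lemma layer_Suc:
  "(1 - y) * layer y (Suc n)
    = layer 1 n - y * layer y n + (1 - y) * (Z - 1) * layer 1 n
      + U * y * layer y n - U * y\<^sup>2 * (layer 1 n oo (U * y))
      + (1 - y) * U * y * ((Z * X) ^ n - (if n = 0 then 1 else 0))"
proof -
  have rep: "run (replicate n 0 @ [1]) = n" "zeros (replicate n 0 @ [1]) = n"
    "asc (replicate n 0 @ [1]) = of_bool (n \<noteq> 0)"
    by (auto simp: run_snoc zeros_snoc asc_snoc, simp add: zeros_def)
  have "(1 - y) * layer y (Suc n)
      = (\<Sum>w\<in>nonzero_seqs n. (1 - y) * (\<Sum>x\<le>1 + asc w. weight y (w @ [x])))
      + (1 - y) * (if n = 0 then 0 else weight y (replicate n 0 @ [1]))"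
    by (simp only: layer_def sum_nonzero_seqs_Suc distrib_left sum_distrib_left)
  \<comment> \<open>Subtracting the indicator of \<open>n = 0\<close> removes the word
    \<open>[1]\<close>, which is no ascent sequence, and keeps a plain power of \<open>Z * X\<close>
    to sum.\<close>
  also have "(if n = 0 then 0 else weight y (replicate n 0 @ [1]))
      = U * y * ((Z * X) ^ n - (if n = 0 then 1 else 0))"
    by (simp add: weight_def rep power_mult_distrib del: One_nat_def)
  also have "(\<Sum>w\<in>nonzero_seqs n. (1 - y) * (\<Sum>x\<le>1 + asc w. weight y (w @ [x])))
    = (\<Sum>w\<in>nonzero_seqs n. weight 1 w - y * weight y w + (1 - y) * (Z - 1) * weight 1 w
      + U * y * weight y w - U * y\<^sup>2 * (weight 1 w oo (U * y)))"
    by (intro sum.cong) (simp_all only: sum_weight_snoc weight_compose)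
  also have "\<dots> = layer 1 n - y * layer y n + (1 - y) * (Z - 1) * layer 1 n
      + U * y * layer y n - U * y\<^sup>2 * (layer 1 n oo (U * y))"
    by (simp add: layer_def sum.distrib sum_subtractf sum_distrib_left fps_compose_sum_distrib)
  finally show ?thesis by (simp only: mult.assoc)
qed

text \<open>The variable marking the last entry is replaced by an arbitrary series \<open>y\<close>, whose powers need
  not converge to 0: the sum is \<open>T\<close>-adic and each layer is finite.\<close>

definition nonzero_gf :: "mfps \<Rightarrow> mfps" where
  "nonzero_gf y = fps_series2 (layer y)"

lemma geometric_T:
  assumes "c * T = d" "d $ 0 $ 0 $ 0 $ 0 $ 0 = 0"
  shows "fps_series2 (\<lambda>n. c ^ n) = inverse (1 - d)"
proof -
  have 1: "fps_series2 (\<lambda>n. c ^ n) * (1 - d) = 1"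
    using fps_series2_geometric[of c] assms by (simp add: T_def mult.commute)
  have "(1 - d) * inverse (1 - d) = 1"
    by (rule mfps_mult_inverse) (use assms in simp)
  with 1 show ?thesis by (rule left_inverse_eq_right_inverse)
qed

text \<open>\<open>layer_Suc\<close> is multiplied by \<open>T ^ (n + 1)\<close> and summed over
  \<open>n\<close>. Since \<open>delta 1 = 1 - T + T * U\<close>, the terms in
  \<open>nonzero_gf y\<close> collect to the kernel.\<close>

lemma nonzero_gf_eq:
  "(y * delta 1 - 1) * nonzero_gf y
    = (y - 1) * y * (T ^ 2 * Z * X * U * inverse (1 - T * Z * X))
      + T * (Z * (y - 1) - y) * nonzero_gf 1 + T * U * y\<^sup>2 * (nonzero_gf 1 oo (U * y))"
proof -
  define P where "P = nonzero_gf 1"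
  define I where "I = inverse (1 - T * Z * X)"
  have I: "fps_series2 (\<lambda>n. (Z * X) ^ n) = I"
    unfolding I_def by (rule geometric_T) (simp_all add: T_def Z_def X_def algebra_simps)
  have I': "I = 1 + T * Z * X * I"
    using mfps_mult_inverse[of "1 - T * Z * X"]
    by (simp add: I_def T_def Z_def X_def algebra_simps)
  \<comment> \<open>Scaling by 0 shows that the sum of the zero sequence vanishes, so only the term
    \<open>n = 0\<close> is left.\<close>
  have delta0: "fps_series2 (\<lambda>n. if n = 0 then 1 else 0) = (1::mfps)"
    using fps_series2_rec[of "\<lambda>n. if n = 0 then 1 else 0 :: mfps"]
      fps_series2_mult_left[of 0 "\<lambda>n. 0::mfps"]
    by simp
  have "(1 - y) * nonzero_gf y = T * ((1 - y) * fps_series2 (\<lambda>n. layer y (Suc n)))"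
    unfolding nonzero_gf_def by (subst fps_series2_rec) (simp add: layer_def T_def algebra_simps)
  also have "(1 - y) * fps_series2 (\<lambda>n. layer y (Suc n)) =
     fps_series2 (\<lambda>n. layer 1 n - y * layer y n + (1 - y) * (Z - 1) * layer 1 n
      + U * y * layer y n - U * y\<^sup>2 * (layer 1 n oo (U * y))
      + (1 - y) * U * y * ((Z * X) ^ n - (if n = 0 then 1 else 0)))"
    by (simp only: fps_series2_mult_left[symmetric] layer_Suc)
  also have "\<dots> =
     P - y * nonzero_gf y + (1 - y) * (Z - 1) * P + U * y * nonzero_gf y
      - U * y\<^sup>2 * (P oo (U * y)) + (1 - y) * U * y * (I - 1)"
    by (simp only: fps_series2_add fps_series2_diff fps_series2_mult_left I delta0 P_def
        nonzero_gf_def fps_series2_compose)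
  also have "I - 1 = T * Z * X * I"
    by (subst I') simp
  finally have E: "(1 - y) * nonzero_gf y = T * (P - y * nonzero_gf y + (1 - y) * (Z - 1) * P
      + U * y * nonzero_gf y - U * y\<^sup>2 * (P oo (U * y)) + (1 - y) * U * y * (T * Z * X * I))" .
  \<comment> \<open>A plain ring identity: up to sign, the two sides of the claim differ by what the
    two sides of \<open>E\<close> differ by.\<close>
  have "(y * delta 1 - 1) * nonzero_gf y - ((y - 1) * y * (T ^ 2 * Z * X * U * I)
      + T * (Z * (y - 1) - y) * P + T * U * y\<^sup>2 * (P oo (U * y)))
    = T * (P - y * nonzero_gf y + (1 - y) * (Z - 1) * P
      + U * y * nonzero_gf y - U * y\<^sup>2 * (P oo (U * y)) + (1 - y) * U * y * (T * Z * X * I))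
      - (1 - y) * nonzero_gf y"
    by (simp add: delta_def algebra_simps power2_eq_square)
  then show ?thesis
    using E unfolding P_def[symmetric] I_def[symmetric] by simp
qed

section \<open>Coefficients of the generating function \<open>G\<close>\<close>

lemma fps_series2_nth:
  assumes "\<And>n m j. j > 0 \<Longrightarrow> f n $ m $ j = 0"
  shows "fps_series2 f $ m $ n = f n $ m $ 0"
proof -
  have "fps_series2 f $ m $ n = (\<Sum>i\<le>n. f i $ m $ (n - i))"
    by (simp add: fps_series2_def fps_series_def)
  \<comment> \<open>No \<open>f i\<close> involves the inner variable, so only \<open>i = n\<close>
    reaches the exponent \<open>n\<close>.\<close>
  also have "\<dots> = (\<Sum>i\<le>n. if i = n then f n $ m $ 0 else 0)"
    by (intro sum.cong) (auto simp: assms)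
  finally show ?thesis by simp
qed

lemma monomial_nth:
  "(U ^ a * V ^ l * Z ^ k * X ^ r) $ a' $ n $ l' $ k' $ r'
    = of_bool (a' = a \<and> n = 0 \<and> l' = l \<and> k' = k \<and> r' = r)"
proof -
  have "U ^ a * V ^ l * Z ^ k * X ^ r = fps_X ^ a * fps_const (fps_const (fps_X ^ l *
      fps_const (fps_X ^ k * fps_const (fps_X ^ r))))"
    by (simp add: U_def V_def Z_def X_def mult.assoc)
  then show ?thesis
    by (simp add: fps_X_power_nth)
qed

lemma monomial_nth_T_pos:
  "j > 0 \<Longrightarrow> (U ^ a * V ^ l * Z ^ k * X ^ r) $ m $ j = 0"
  by (simp add: fps_eq_iff monomial_nth)

lemma G_eq: "G = inverse (1 - T * Z) + nonzero_gf V"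
proof -
  have rep: "run (replicate n 0) = 0" "zeros (replicate n 0) = n" "lastv (replicate n 0) = 0" for n
    by (auto simp: run_def zeros_def lastv_def)
  have "G $ a $ n $ l $ k $ r = (inverse (1 - T * Z) + nonzero_gf V) $ a $ n $ l $ k $ r" for a n l k r
  proof -
    define Q where "Q w \<longleftrightarrow> asc w = a \<and> lastv w = l
        \<and> zeros w = k \<and> run w = r" for w
    define C where "C = (if Q (replicate n 0) then {replicate n (0::nat)} else {})"
    have "ascent_seq w \<and> length w = n \<and> asc w = a \<and> lastv w = l
          \<and> zeros w = k \<and> run w = r
        \<longleftrightarrow> w \<in> (nonzero_seqs n \<inter> {w. Q w}) \<union> C" for w
    proof (cases "w = replicate n 0")
      case True
      then show ?thesis by (auto simp: nonzero_seqs_def C_def Q_def)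
    next
      case False
      then have "length w = n \<Longrightarrow> \<exists>a\<in>set w. a \<noteq> 0"
        using replicate_eqI[of w n 0] by blast
      then show ?thesis using False by (auto simp: nonzero_seqs_def C_def Q_def)
    qed
    then have split: "{w. ascent_seq w \<and> length w = n \<and> asc w = a \<and> lastv w = l
          \<and> zeros w = k \<and> run w = r}
      = (nonzero_seqs n \<inter> {w. Q w}) \<union> C"
      by blast
    have "card ((nonzero_seqs n \<inter> {w. Q w}) \<union> C)
        = card (nonzero_seqs n \<inter> {w. Q w}) + card C"
      by (rule card_Un_disjoint) (simp_all add: C_def, simp add: nonzero_seqs_def)
    then have G: "G $ a $ n $ l $ k $ r = of_nat (card (nonzero_seqs n \<inter> {w. Q w}))
        + of_bool (Q (replicate n 0))"
      by (simp add: G_def split C_def)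
    have "inverse (1 - T * Z) = fps_series2 (\<lambda>n. Z ^ n)"
      by (rule geometric_T[symmetric]) (simp_all add: T_def Z_def mult.commute)
    \<comment> \<open>\<open>Z ^ n\<close> is padded to a full monomial so that
      \<open>monomial_nth\<close> reads off its coefficients.\<close>
    then have "inverse (1 - T * Z) = fps_series2 (\<lambda>n. U ^ 0 * V ^ 0 * Z ^ n * X ^ 0)"
      by simp
    then have 1: "inverse (1 - T * Z) $ a $ n $ l $ k $ r = of_bool (Q (replicate n 0))"
      by (simp only: fps_series2_nth[OF monomial_nth_T_pos] monomial_nth Q_def rep asc_replicate)
        (auto simp del: of_bool_eq_iff intro: arg_cong[of _ _ of_bool])
    have "nonzero_gf V $ a $ n = layer V n $ a $ 0"
      unfolding nonzero_gf_def
      by (rule fps_series2_nth)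
        (simp add: layer_def fps_sum_nth weight_def monomial_nth_T_pos)
    also have "\<dots> $ l $ k $ r = (\<Sum>w\<in>nonzero_seqs n. weight V w $ a $ 0 $ l $ k $ r)"
      by (simp add: layer_def fps_sum_nth)
    also have "\<dots> = (\<Sum>w\<in>nonzero_seqs n. of_bool (Q w))"
      by (intro sum.cong refl) (auto simp: weight_def monomial_nth Q_def)
    finally show ?thesis using G 1 by (simp add: sum_of_bool_eq)
  qed
  then show ?thesis by (simp add: fps_eq_iff)
qed

subsection \<open>Solving the kernel equation\<close>

lemma compose_inverse:
  fixes f :: mfps
  assumes h: "h $ 0 = 0" and f: "f $ 0 $ 0 $ 0 $ 0 $ 0 \<noteq> 0"
  shows "inverse f oo h = inverse (f oo h)"
proof (rule left_inverse_eq_right_inverse)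
  have "f * inverse f = 1" using f by (rule mfps_mult_inverse)
  then show "(inverse f oo h) * (f oo h) = 1"
    by (simp add: fps_compose_mult_distrib[OF h, symmetric] mult.commute)
  show "(f oo h) * inverse (f oo h) = 1"
    by (rule mfps_mult_inverse) (use f in simp)
qed

lemma inverse_mult_mfps:
  fixes f g :: mfps
  assumes "f $ 0 $ 0 $ 0 $ 0 $ 0 \<noteq> 0" "g $ 0 $ 0 $ 0 $ 0 $ 0 \<noteq> 0"
  shows "inverse (f * g) = inverse f * inverse g"
proof (rule left_inverse_eq_right_inverse[symmetric])
  have "inverse f * inverse g * (f * g) = (f * inverse f) * (g * inverse g)"
    by (simp only: ac_simps)
  then show "inverse f * inverse g * (f * g) = 1"
    by (simp only: mfps_mult_inverse[OF assms(1)] mfps_mult_inverse[OF assms(2)] mult_1)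
  show "f * g * inverse (f * g) = 1"
    using assms by (intro mfps_mult_inverse) simp
qed

abbreviation const_coeff :: "mfps \<Rightarrow> rat" where "const_coeff f \<equiv> f $ 0 $ 0 $ 0 $ 0 $ 0"

lemma const_coeff_power: "const_coeff (f ^ n) = const_coeff f ^ n"
  by (induction n) simp_all

lemma const_coeff_prod: "const_coeff (prod f I) = (\<Prod>i\<in>I. const_coeff (f i))"
  by (induction I rule: infinite_finite_induct) simp_all

lemma const_coeff_vars [simp]:
  "const_coeff T = 0" "const_coeff U = 0" "const_coeff V = 0" "const_coeff Z = 0" "const_coeff X = 0"
  by (simp_all add: T_def U_def V_def Z_def X_def)

lemma const_coeff_delta [simp]: "const_coeff (delta s) = 1"
  and const_coeff_gamma [simp]: "const_coeff (gamma s) = 1"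
  by (simp_all add: delta_def gamma_def const_coeff_power)

section \<open>The substitution of \<open>U / delta 1\<close> for \<open>U\<close>\<close>

definition denom :: "nat \<Rightarrow> mfps" where
  "denom s = delta s * delta (s + 1) * (\<Prod>i = 1..s + 1. gamma i)"

lemma const_coeff_denom [simp]: "const_coeff (denom s) = 1"
  by (simp add: denom_def const_coeff_prod del: prod.cl_ivl_Suc)

definition delta1_inv :: mfps where "delta1_inv = inverse (delta 1)"

lemma delta1_mult_inv: "delta 1 * delta1_inv = 1"
  unfolding delta1_inv_def by (rule mfps_mult_inverse) simp

lemma compose_one_minus_T: "(1 - T) ^ n oo h = (1 - T) ^ n" if "h $ 0 = 0"
  using fps_compose_power[OF that, of "1 - T" n] by (simp add: fps_compose_sub_distrib)

text \<open>Multiplying by \<open>delta 1\<close> clears the denominator, and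
  \<open>U - delta 1 = (1 - T) * (U - 1)\<close> supplies the extra factor \<open>1 - T\<close> that
  raises the index.\<close>

lemma delta_compose: "delta 1 * (delta s oo (U * delta1_inv)) = delta (s + 1)"
proof (cases "s = 0")
  case False
  have "delta 1 * (delta s oo (U * delta1_inv))
      = delta 1 * (U * delta1_inv - (1 - T) ^ s * (U * delta1_inv - 1))"
    using False by (simp add: delta_def fps_compose_sub_distrib fps_compose_mult_distrib compose_one_minus_T)
  also have "\<dots> = U * (delta 1 * delta1_inv) - (1 - T) ^ s * (U * (delta 1 * delta1_inv) - delta 1)"
    by (simp add: algebra_simps)
  also have "\<dots> = delta (s + 1)"
    unfolding delta1_mult_inv by (simp add: delta_def algebra_simps)
  finally show ?thesis .
qed (simp add: delta_def)

text \<open>The same computation as for \<open>delta_compose\<close>. Index 0 is excluded because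
  \<open>gamma 0 = 1\<close> would go to \<open>delta 1\<close> instead of
  \<open>gamma 1\<close>.\<close>

lemma gamma_compose:
  assumes "s \<ge> 1"
  shows "delta 1 * (gamma s oo (U * delta1_inv)) = gamma (s + 1)"
proof -
  obtain m where s: "s = Suc m" using assms by (cases s) auto
  have "delta 1 * (gamma s oo (U * delta1_inv))
      = delta 1 * (U * delta1_inv - (1 - Z * T) * (1 - T) ^ m * (U * delta1_inv - 1))"
    using s by (simp add: gamma_def fps_compose_sub_distrib fps_compose_mult_distrib compose_one_minus_T)
  also have "\<dots> = U * (delta 1 * delta1_inv) - (1 - Z * T) * (1 - T) ^ m *
      (U * (delta 1 * delta1_inv) - delta 1)"
    by (simp add: algebra_simps)
  also have "\<dots> = gamma (s + 1)"
    unfolding delta1_mult_inv s by (simp add: delta_def gamma_def algebra_simps)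
  finally show ?thesis .
qed

text \<open>The exponent counts two delta factors and \<open>s + 1\<close> gamma factors. All
  indices move up by one, so \<open>gamma 1\<close> has to be supplied as the new first factor of
  the product.\<close>

lemma denom_compose: "delta 1 ^ (s + 3) * gamma 1 * (denom s oo (U * delta1_inv)) = denom (s + 1)"
proof -
  have "delta 1 ^ (s + 1) * (\<Prod>i = 1..s + 1. gamma i oo (U * delta1_inv))
      = (\<Prod>i = 1..s + 1. delta 1 * (gamma i oo (U * delta1_inv)))"
    unfolding prod.distrib by (simp add: prod_constant)
  also have "\<dots> = (\<Prod>i = 1..s + 1. gamma (i + 1))"
    by (intro prod.cong refl gamma_compose) auto
  also have "gamma 1 * \<dots> = (\<Prod>i = 1..s + 2. gamma i)"
    by (subst (2) prod.atLeast_Suc_atMost) (auto simp: prod.shift_bounds_cl_Suc_ivl simp del: prod.cl_ivl_Suc)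
  finally have 1: "gamma 1 * (delta 1 ^ (s + 1) * (\<Prod>i = 1..s + 1. gamma i oo (U * delta1_inv)))
      = (\<Prod>i = 1..s + 2. gamma i)"
    by simp
  have "denom s oo (U * delta1_inv) = (delta s oo (U * delta1_inv)) * (delta (s + 1) oo (U * delta1_inv)) *
      (\<Prod>i = 1..s + 1. gamma i oo (U * delta1_inv))"
    unfolding denom_def by (simp add: fps_compose_mult_distrib fps_compose_prod_distrib del: prod.cl_ivl_Suc)
  then have "delta 1 ^ (s + 3) * gamma 1 * (denom s oo (U * delta1_inv))
     = (delta 1 * (delta s oo (U * delta1_inv))) * (delta 1 * (delta (s + 1) oo (U * delta1_inv))) *
       (gamma 1 * (delta 1 ^ (s + 1) * (\<Prod>i = 1..s + 1. gamma i oo (U * delta1_inv))))"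
    by (simp add: power_add power3_eq_cube ac_simps del: prod.cl_ivl_Suc)
  then show ?thesis unfolding 1 delta_compose by (simp add: denom_def add.assoc)
qed

definition kernel_series :: mfps where
  "kernel_series = fps_series (\<lambda>s. (1 - T) ^ s * inverse (denom s))"

text \<open>The term \<open>s = 0\<close> gives the summand 1. Every later term is the image of its
  predecessor under the substitution, up to a factor common to all terms.\<close>

lemma kernel_series_rec:
  "kernel_series = delta1_inv * inverse (gamma 1) *
    (1 + U * delta1_inv\<^sup>2 * (1 - T) * (kernel_series oo (U * delta1_inv)))"
proof -
  define S' where "S' = fps_series (\<lambda>s. (1 - T) ^ (s + 1) * inverse (denom (s + 1)))"
  have g: "gamma 1 * inverse (gamma 1) = 1"
    by (rule mfps_mult_inverse) simp
  have "denom 0 = delta 1 * gamma 1"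
    by (simp add: denom_def) (simp add: delta_def)
  then have "inverse (denom 0) = delta1_inv * inverse (gamma 1)"
    by (simp only: delta1_inv_def inverse_mult_mfps const_coeff_delta const_coeff_gamma
        zero_neq_one[symmetric] not_False_eq_True)
  then have S0: "kernel_series = delta1_inv * inverse (gamma 1) + U * S'"
    unfolding kernel_series_def S'_def by (subst fps_series_rec) (simp add: U_def)
  \<comment> \<open>Substituting into \<open>U ^ s\<close> produces \<open>delta1_inv ^ s\<close>,
    which cancels \<open>s\<close> of the \<open>s + 3\<close> factors \<open>delta 1\<close> in
    \<open>denom_compose\<close>; the factor left in front no longer depends on
    \<open>s\<close>.\<close>
  have inv: "delta1_inv ^ s * inverse (denom s oo (U * delta1_inv))
      = delta 1 ^ 3 * gamma 1 * inverse (denom (s + 1))" for s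
  proof -
    have "inverse (denom s oo (U * delta1_inv)) = delta 1 ^ (s + 3) * gamma 1 * inverse (denom (s + 1))"
    proof (rule left_inverse_eq_right_inverse)
      show "inverse (denom s oo (U * delta1_inv)) * (denom s oo (U * delta1_inv)) = 1"
        by (subst mult.commute, rule mfps_mult_inverse) simp
      have "(denom s oo (U * delta1_inv)) * (delta 1 ^ (s + 3) * gamma 1 * inverse (denom (s + 1)))
        = denom (s + 1) * inverse (denom (s + 1))"
        unfolding denom_compose[symmetric] by (simp only: ac_simps)
      also have "\<dots> = 1" by (rule mfps_mult_inverse) simp
      finally show "(denom s oo (U * delta1_inv)) *
          (delta 1 ^ (s + 3) * gamma 1 * inverse (denom (s + 1))) = 1" .
    qed
    then have "delta1_inv ^ s * inverse (denom s oo (U * delta1_inv))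
        = (delta 1 * delta1_inv) ^ s * (delta 1 ^ 3 * gamma 1 * inverse (denom (s + 1)))"
      by (simp add: power_add power_mult_distrib ac_simps)
    then show ?thesis by (simp only: delta1_mult_inv power_one mult_1)
  qed
  have "(1 - T) * (kernel_series oo (U * delta1_inv))
      = (1 - T) * fps_series (\<lambda>s. delta1_inv ^ s * ((1 - T) ^ s * inverse (denom s)
          oo (U * delta1_inv)))"
    unfolding kernel_series_def U_def by (subst fps_series_compose) (rule refl)
  also have "(\<lambda>s. delta1_inv ^ s * ((1 - T) ^ s * inverse (denom s) oo (U * delta1_inv)))
      = (\<lambda>s. (1 - T) ^ s * (delta1_inv ^ s * inverse (denom s oo (U * delta1_inv))))"
    by (simp add: fps_compose_mult_distrib compose_one_minus_T compose_inverse ac_simps)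
  also have "(1 - T) * fps_series \<dots> = delta 1 ^ 3 * gamma 1 * S'"
    unfolding inv S'_def fps_series_mult_left[symmetric] by (simp add: ac_simps)
  finally have "delta1_inv * inverse (gamma 1) * U * delta1_inv\<^sup>2 *
      ((1 - T) * (kernel_series oo (U * delta1_inv)))
      = (delta 1 * delta1_inv) ^ 3 * (gamma 1 * inverse (gamma 1)) * U * S'"
    by (simp add: power_mult_distrib power2_eq_square power3_eq_cube ac_simps)
  then have US: "U * S' = delta1_inv * inverse (gamma 1) * U * delta1_inv\<^sup>2 *
      ((1 - T) * (kernel_series oo (U * delta1_inv)))"
    unfolding delta1_mult_inv g by (simp only: power_one mult_1)
  have "delta1_inv * inverse (gamma 1) + U * S' =
      delta1_inv * inverse (gamma 1) *
        (1 + U * delta1_inv\<^sup>2 * (1 - T) * (kernel_series oo (U * delta1_inv)))"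
    unfolding US by (simp only: distrib_left mult_1 mult_1_right ac_simps)
  with S0 show ?thesis by (rule trans)
qed

text \<open>The series A of the words \<open>0^r 1\<close> with \<open>r >= 1\<close>, the last
  entry unmarked.\<close>

definition base_gf :: mfps where "base_gf = T ^ 2 * Z * X * U * inverse (1 - T * Z * X)"

lemma base_gf_compose: "base_gf oo (U * y) = base_gf * y"
  using fps_compose_power[of "U * y" T 2]
  by (simp add: base_gf_def fps_compose_mult_distrib compose_inverse fps_compose_sub_distrib ac_simps)

text \<open>At \<open>y = delta1_inv\<close> the kernel \<open>y * delta 1 - 1\<close> vanishes.\<close>

lemma nonzero_gf_1: "nonzero_gf 1 = base_gf * (1 - U) * kernel_series"
proof -
  define P where "P = nonzero_gf 1"
  define i where "i = inverse (gamma 1)"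
  define d where "d = delta 1"
  have g: "gamma 1 * i = 1"
    unfolding i_def by (rule mfps_mult_inverse) simp
  have dD: "d * delta1_inv = 1" unfolding d_def by (rule delta1_mult_inv)
  have d: "d = 1 - T * (1 - U)"
    by (simp add: d_def delta_def algebra_simps)
  have g1: "gamma 1 = 1 - Z * T * (1 - U)"
    by (simp add: gamma_def algebra_simps)
  have "delta1_inv * d = 1" using dD by (simp only: mult.commute)
  then have "0 = (delta1_inv - 1) * delta1_inv * base_gf
      + T * (Z * (delta1_inv - 1) - delta1_inv) * P + T * U * delta1_inv\<^sup>2 * (P oo (U * delta1_inv))"
    using nonzero_gf_eq[of delta1_inv] by (simp add: base_gf_def P_def d_def[symmetric] del: One_nat_def)
  \<comment> \<open>The factor \<open>d\<^sup>2\<close> clears every \<open>delta1_inv\<close>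
    outside the composition.\<close>
  then have "0 = d\<^sup>2 * ((delta1_inv - 1) * delta1_inv * base_gf
      + T * (Z * (delta1_inv - 1) - delta1_inv) * P + T * U * delta1_inv\<^sup>2 * (P oo (U * delta1_inv)))"
    by simp
  also have "\<dots> = (d * delta1_inv - d) * (d * delta1_inv) * base_gf
      + T * d * (Z * (d * delta1_inv - d) - d * delta1_inv) * P
      + T * U * (d * delta1_inv)\<^sup>2 * (P oo (U * delta1_inv))"
    by (simp add: algebra_simps power2_eq_square)
  \<comment> \<open>\<open>1 - d = T * (1 - U)\<close> brings out the common factor \<open>T\<close>
    and turns \<open>1 - Z * (1 - d)\<close> into \<open>gamma 1\<close>.\<close>
  also have "\<dots> = T * ((1 - U) * base_gf - d * gamma 1 * P + U * (P oo (U * delta1_inv)))"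
    unfolding dD unfolding d g1 by (simp add: algebra_simps)
  finally have "T * ((1 - U) * base_gf - d * gamma 1 * P + U * (P oo (U * delta1_inv))) = 0"
    by simp
  moreover have "T \<noteq> 0" by (simp add: T_def)
  ultimately have "(1 - U) * base_gf - d * gamma 1 * P + U * (P oo (U * delta1_inv)) = 0"
    by (metis mult_eq_0_iff)
  then have dP: "d * gamma 1 * P = (1 - U) * base_gf + U * (P oo (U * delta1_inv))"
    by (simp add: algebra_simps)
  have "P = (d * delta1_inv) * (gamma 1 * i) * P" by (simp only: dD g mult_1)
  also have "\<dots> = delta1_inv * i * (d * gamma 1 * P)" by (simp only: ac_simps)
  finally have P: "P = delta1_inv * i * (1 - U) * base_gf
      + fps_X * (delta1_inv * i) * (P oo (fps_X * delta1_inv))"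
    unfolding dP U_def by (simp add: algebra_simps)
  define Q where "Q = base_gf * (1 - U) * kernel_series"
  \<comment> \<open>Under the substitution the factor \<open>1 - U\<close> of \<open>Q\<close>
    yields \<open>delta1_inv * (1 - T)\<close> and \<open>base_gf\<close> yields another
    \<open>delta1_inv\<close>: exactly the factors in \<open>kernel_series_rec\<close>, so
    \<open>Q\<close> solves the equation of \<open>P\<close>.\<close>
  have "1 - U * delta1_inv = d * delta1_inv - U * delta1_inv" by (simp only: dD)
  also have "\<dots> = delta1_inv * ((1 - T) * (1 - U))" unfolding d by (simp add: algebra_simps)
  finally have UD: "1 - U * delta1_inv = delta1_inv * ((1 - T) * (1 - U))" .
  have "Q oo (U * delta1_inv) = base_gf * delta1_inv * (1 - U * delta1_inv) *
      (kernel_series oo (U * delta1_inv))"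
    by (simp add: Q_def fps_compose_mult_distrib fps_compose_sub_distrib base_gf_compose)
  then have Qc: "Q oo (U * delta1_inv)
      = base_gf * delta1_inv\<^sup>2 * (1 - T) * (1 - U) * (kernel_series oo (U * delta1_inv))"
    unfolding UD by (simp only: power2_eq_square ac_simps)
  have "Q = base_gf * (1 - U) * (delta1_inv * i *
      (1 + U * delta1_inv\<^sup>2 * (1 - T) * (kernel_series oo (U * delta1_inv))))"
    unfolding Q_def i_def by (subst kernel_series_rec) (rule refl)
  also have "\<dots> = delta1_inv * i * (1 - U) * base_gf + U * (delta1_inv * i) * (Q oo (U * delta1_inv))"
    unfolding Qc by (simp only: distrib_left mult_1 mult_1_right ac_simps)
  finally have "Q = delta1_inv * i * (1 - U) * base_gf
      + fps_X * (delta1_inv * i) * (Q oo (fps_X * delta1_inv))"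
    unfolding U_def .
  with P have "P = Q" by (rule fps_compose_equation_unique)
  then show ?thesis by (simp add: P_def Q_def)
qed

section \<open>The barred series and the final formula\<close>

lemma deltabar_eq: "deltabar s = delta s oo (U * V)"
  by (simp add: deltabar_def delta_def fps_compose_sub_distrib fps_compose_mult_distrib compose_one_minus_T)

lemma gammabar_eq: "gammabar s = gamma s oo (U * V)"
  by (simp add: gammabar_def gamma_def fps_compose_sub_distrib fps_compose_mult_distrib compose_one_minus_T)

lemma kernel_series_suminf:
  "(\<Sum>s. U ^ s * (1 - T) ^ s *
      inverse (delta s * delta (s + 1) * (\<Prod>i = 1..s + 1. gamma i))) = kernel_series"
  using sums_unique[OF fps_series_sums[of "\<lambda>s. (1 - T) ^ s * inverse (denom s)"]]
  by (simp only: kernel_series_def U_def denom_def mult.assoc)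

text \<open>The barred sum is the plain one with \<open>U * V\<close> for \<open>U\<close>. The
  expansion is in powers of \<open>U\<close> alone, so \<open>V ^ s\<close> is absorbed into the
  terms.\<close>

lemma kernel_series_compose_suminf:
  "(\<Sum>s. (U * V) ^ s * (1 - T) ^ s
      * inverse (deltabar s * deltabar (s + 1) * (\<Prod>i = 1..s + 1. gammabar i)))
    = kernel_series oo (U * V)"
proof -
  have "denom s oo (U * V) = deltabar s * deltabar (s + 1) * (\<Prod>i = 1..s + 1. gammabar i)" for s
    by (simp add: denom_def fps_compose_mult_distrib fps_compose_prod_distrib deltabar_eq
        gammabar_eq del: prod.cl_ivl_Suc)
  then have *: "(\<lambda>s. (1 - T) ^ s * inverse (denom s) oo (U * V)) = (\<lambda>s. (1 - T) ^ s *
      inverse (deltabar s * deltabar (s + 1) * (\<Prod>i = 1..s + 1. gammabar i)))"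
    by (simp add: fps_compose_mult_distrib compose_one_minus_T compose_inverse del: prod.cl_ivl_Suc)
  have "kernel_series oo (U * V)
      = fps_series (\<lambda>s. V ^ s * ((1 - T) ^ s * inverse (denom s) oo (U * V)))"
    unfolding kernel_series_def U_def by (rule fps_series_compose)
  also note *
  finally show ?thesis
    using sums_unique[OF fps_series_sums[of "\<lambda>s. V ^ s * ((1 - T) ^ s *
      inverse (deltabar s * deltabar (s + 1) * (\<Prod>i = 1..s + 1. gammabar i)))"]]
    by (simp only: U_def power_mult_distrib mult.assoc)
qed

theorem theorem4:
  shows "G = inverse (1 - T * Z)
    + T ^ 2 * Z * X * U * inverse ((1 - T * Z * X) * (V * delta 1 - 1))
      * ( V * (V - 1)
        + T * (1 - U) * (Z * (V - 1) - V)
            * (\<Sum>s. U ^ s * (1 - T) ^ s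
                 * inverse (delta s * delta (s + 1) * (\<Prod>i = 1..s + 1. gamma i)))
        + U * V ^ 3 * T * (1 - U * V)
            * (\<Sum>s. (U * V) ^ s * (1 - T) ^ s
                 * inverse (deltabar s * deltabar (s + 1) * (\<Prod>i = 1..s + 1. gammabar i))))"
proof -
  define K where "K = V * delta 1 - 1"
  have cK: "const_coeff K \<noteq> 0" by (simp add: K_def)
  have "inverse K * K = 1"
    using mfps_mult_inverse[OF cK] by (simp only: mult.commute)
  then have "nonzero_gf V = inverse K * (K * nonzero_gf V)"
    by (simp only: mult.assoc[symmetric] mult_1)
  \<comment> \<open>The kernel equation at \<open>y = V\<close>. Composing \<open>base_gf\<close>
    with \<open>U * V\<close> contributes one more \<open>V\<close>, which makes the
    \<open>V ^ 3\<close> of the theorem.\<close>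
  also have "K * nonzero_gf V = (V - 1) * V * base_gf
      + T * (Z * (V - 1) - V) * (base_gf * (1 - U) * kernel_series)
      + T * U * V\<^sup>2 * (base_gf * V * (1 - U * V) * (kernel_series oo (U * V)))"
    unfolding K_def nonzero_gf_eq nonzero_gf_1
    by (simp add: base_gf_def[symmetric] fps_compose_mult_distrib fps_compose_sub_distrib base_gf_compose)
  also have "\<dots> = base_gf * (V * (V - 1) + T * (1 - U) * (Z * (V - 1) - V) * kernel_series
      + U * V ^ 3 * T * (1 - U * V) * (kernel_series oo (U * V)))"
    by (simp add: algebra_simps power2_eq_square power3_eq_cube)
  also have "inverse K * \<dots> = T ^ 2 * Z * X * U * (inverse (1 - T * Z * X) * inverse K) *
     (V * (V - 1) + T * (1 - U) * (Z * (V - 1) - V) * kernel_series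
      + U * V ^ 3 * T * (1 - U * V) * (kernel_series oo (U * V)))"
    unfolding base_gf_def by (simp only: ac_simps)
  also have "inverse (1 - T * Z * X) * inverse K = inverse ((1 - T * Z * X) * K)"
    using cK by (intro inverse_mult_mfps[symmetric]) simp_all
  finally show ?thesis
    unfolding G_eq kernel_series_suminf kernel_series_compose_suminf K_def by simp
qed

end
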